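(* Let $m,n\in\mathbb{N}$ (positive integers) and $a,b\in\mathbb{Z}$ with $a\neq 0$ and $b\neq 0$. Then for all $x,y,z\in\mathbb{R}$, \begin{align*} &\overline{B}_{m}(ax+y)\,\overline{B}_{n}(bx+z)\\ &=n\,b^{n-1}\mathrm{sgn}(b)\sum_{j=0}^{m}\binom{m}{j}\frac{(-1)^{j}a^{m-j}}{m+n-j}\sum_{l=1}^{|b|}\overline{B}_{j}\Bigl(\frac{a(l+z)}{b}-y\Bigr)\overline{B}_{m+n-j}\Bigl(x+\frac{l+z}{b}\Bigr)\\ &\quad+m\,a^{m-1}\mathrm{sgn}(a)\sum_{j=0}^{n}\binom{n}{j}\frac{(-1)^{j}b^{n-j}}{m+n-j}\sum_{l=1}^{|a|}\overline{B}_{j}\Bigl(\frac{b(l+y)}{a}-z\Bigr)\overline{B}_{m+n-j}\Bigl(x+\frac{l+y}{a}\Bigr)\\ &\quad+\frac{(-1)^{n-1}m!\,n!\,(a,b)^{m+n}\,\overline{B}_{m+n}\bigl(\frac{by-az}{(a,b)}\bigr)}{a^{n}b^{m}(m+n)!} -\delta_{1,m}\delta_{1,n}\,\mathrm{sgn}(ab)\,\frac{\delta_{\mathbb{Z}}(ax+y)\,\delta_{\mathbb{Z}}(bx+z)}{4}. \end{align*}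
   Context: $\{x\}$ denotes the fractional part of $x\in\mathbb{R}$. $B_n(x)$ is the $n$-th Bernoulli polynomial. The Bernoulli functions are defined for $x\in\mathbb{R}$ by $\overline{B}_{0}(x)=1$, $\overline{B}_{1}(x)=\{x\}-\frac12$ if $x\notin\mathbb{Z}$ and $\overline{B}_{1}(x)=0$ if $x\in\mathbb{Z}$, and $\overline{B}_{n}(x)=B_{n}(\{x\})$ for $n\ge 2$. $\delta_{\mathbb{Z}}(x)=1$ if $x\in\mathbb{Z}$ and $0$ otherwise. $\delta_{l,k}$ is the Kronecker delta. $\mathrm{sgn}(x)$ is the sign of $x$ ($0$ at $0$). $(a,b)$ denotes the (positive) greatest common divisor of $a,b$. $\binom{m}{j}$ is the usual binomial coefficient. *)

theory Defs
  imports Complex_Main "HOL-Computational_Algebra.Formal_Power_Series"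
begin

text \<open>The generating function is \<open>t e\<^bsup>x t\<^esup> / (e\<^bsup>t\<^esup> - 1) = (\<Sum>n. B\<^sub>n(x) t\<^bsup>n\<^esup> / n!)\<close>;
  the quotient is exact since numerator and denominator both have subdegree 1
  (see \<open>bernoulli_poly_generating_function\<close>).\<close>

definition bernoulli_poly :: "nat \<Rightarrow> real \<Rightarrow> real" where
  "bernoulli_poly n x =
     fact n * fps_nth (fps_X * fps_exp x / (fps_exp 1 - 1)) n"

lemma bernoulli_poly_generating_function:
  "Abs_fps (\<lambda>n. bernoulli_poly n x / fact n) * (fps_exp 1 - 1) = fps_X * fps_exp x"
proof -
  let ?f = "fps_X * fps_exp x :: real fps" and ?g = "fps_exp 1 - 1 :: real fps"
  have nth1: "fps_nth ?g 1 = 1" by simp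
  have g0: "?g \<noteq> 0" using nth1 by (metis fps_zero_nth zero_neq_one)
  have "subdegree ?g = 1"
    by (rule subdegreeI) auto
  moreover have "?f \<noteq> 0" by simp
  moreover have "subdegree ?f = 1" by simp
  ultimately have "?g dvd ?f" using g0 by (simp add: fps_dvd_iff)
  moreover have "Abs_fps (\<lambda>n. bernoulli_poly n x / fact n) = ?f / ?g"
    by (rule fps_ext) (simp add: bernoulli_poly_def)
  ultimately show ?thesis by simp
qed

definition bernoulli_fun :: "nat \<Rightarrow> real \<Rightarrow> real" where
  "bernoulli_fun n x =
     (if n = 0 then 1
      else if n = 1 then (if x \<in> \<int> then 0 else frac x - 1/2)
      else bernoulli_poly n (frac x))"

definition delta_Z :: "real \<Rightarrow> real" where
  "delta_Z x = (if x \<in> \<int> then 1 else 0)"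

definition kronecker_delta :: "nat \<Rightarrow> nat \<Rightarrow> real" where
  "kronecker_delta l k = (if l = k then 1 else 0)"

end

theory Submission
  imports Defs "HOL-Computational_Algebra.Polynomial"
begin

text \<open>
  The multiplication formula \<open>B\<^sub>m(y) = a\<^bsup>m-1\<^esup> sgn a (\<Sum>k. B\<^sub>m((y + k)/a))\<close>, applied to both factors,
  reduces the theorem to \<open>a = b = 1\<close>: the sums over \<open>k\<close> and \<open>l\<close> that arise on the right-hand side
  collapse again by the same formula. For \<open>a = b = 1\<close> one may assume \<open>0 \<le> v \<le> u < 1\<close>, where up to the
  value of \<open>B\<^sub>1\<close> at integers the claim is a polynomial identity. Writing
  \<open>G\<^sub>s(x) = s e\<^bsup>s x\<^esup> / (e\<^bsup>s\<^esup> - 1)\<close> and \<open>w = u - v\<close>, that identity is the coefficientwise form of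
  \<open>(s + t) G\<^sub>s(u) G\<^sub>t(v) = t G\<^sub>s(w) G\<^sub>s\<^sub>+\<^sub>t(v) + s G\<^sub>-\<^sub>t(w) G\<^sub>s\<^sub>+\<^sub>t(u)\<close>,
  which follows from \<open>1/((S-1)(T-1)) = 1/((S-1)(S T-1)) + T/((T-1)(S T-1))\<close>.
\<close>

section \<open>Bernoulli polynomials\<close>

text \<open>The series sX e^(sxX) / (e^(sX) - 1). The real parameter s stands in for a second formal
  variable: in a product of two such series with parameters s and t, the coefficient of X^N is
  homogeneous of degree N in s and t.\<close>

definition bernoulli_gf :: "real \<Rightarrow> real \<Rightarrow> real fps" where
  "bernoulli_gf s x = Abs_fps (\<lambda>n. bernoulli_poly n x / fact n * s ^ n)"

lemma bernoulli_gf_nth [simp]: "fps_nth (bernoulli_gf s x) n = bernoulli_poly n x / fact n * s ^ n"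
  by (simp add: bernoulli_gf_def)

text \<open>Substitute sX for X in the defining identity of the generating function. The
  multiplied-out form avoids division of power series.\<close>

lemma bernoulli_gf_eq:
  "bernoulli_gf s x * (fps_exp s - 1) = fps_const s * fps_X * fps_exp (s * x)"
proof -
  let ?c = "fps_const s * fps_X :: real fps"
  have G: "bernoulli_gf s x = Abs_fps (\<lambda>n. bernoulli_poly n x / fact n) oo ?c"
    unfolding fps_compose_linear bernoulli_gf_def by (simp add: mult.commute)
  have "bernoulli_gf s x * (fps_exp s - 1)
      = (Abs_fps (\<lambda>n. bernoulli_poly n x / fact n) * (fps_exp 1 - 1)) oo ?c"
    unfolding G
    by (subst fps_compose_mult_distrib) (simp_all add: fps_compose_sub_distrib)
  also have "\<dots> = (fps_X * fps_exp x) oo ?c"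
    by (simp only: bernoulli_poly_generating_function)
  also have "\<dots> = fps_const s * fps_X * fps_exp (s * x)"
    by (subst fps_compose_mult_distrib) (simp_all add: mult.commute[of x])
  finally show ?thesis .
qed

lemma fps_exp_minus_1_nonzero: "s \<noteq> 0 \<Longrightarrow> fps_exp (s::real) - 1 \<noteq> 0"
proof
  assume "s \<noteq> 0" "fps_exp s - 1 = 0"
  then have "fps_nth (fps_exp s - 1) 1 = 0" by simp
  with \<open>s \<noteq> 0\<close> show False by simp
qed

text \<open>Multiplying numerator and denominator by e^(sX) brings parameter -s over the denominator
  of parameter s. This gives the reflection formula at s = 1 and a common denominator in the
  three-term relation.\<close>

lemma bernoulli_gf_minus_eq:
  "bernoulli_gf (- s) x * (fps_exp s - 1) = fps_const s * fps_X * fps_exp (s * (1 - x))"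
proof -
  have E: "fps_exp (- s) * fps_exp s = 1"
    by (simp flip: fps_exp_add_mult)
  have E': "fps_exp (s * (1 - x)) = fps_exp s * fps_exp (- s * x)"
    by (simp flip: fps_exp_add_mult add: algebra_simps)
  have "bernoulli_gf (- s) x * (fps_exp s - 1) =
        - (bernoulli_gf (- s) x * (fps_exp (- s) - 1)) * fps_exp s"
    using E by (simp add: algebra_simps)
  also have "\<dots> = fps_const s * fps_X * (fps_exp s * fps_exp (- s * x))"
    unfolding bernoulli_gf_eq by (simp flip: fps_const_neg)
  finally show ?thesis
    by (simp only: E')
qed

lemma bernoulli_poly_reflect: "bernoulli_poly n (1 - x) = (- 1) ^ n * bernoulli_poly n x"
proof -
  have "bernoulli_gf 1 (1 - x) * (fps_exp 1 - 1) = bernoulli_gf (- 1) x * (fps_exp 1 - 1)"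
    by (simp only: bernoulli_gf_minus_eq bernoulli_gf_eq)
  then have "bernoulli_gf 1 (1 - x) = bernoulli_gf (- 1) x"
    using fps_exp_minus_1_nonzero[of 1] by simp
  then have "fps_nth (bernoulli_gf 1 (1 - x)) n = fps_nth (bernoulli_gf (- 1) x) n"
    by simp
  then show ?thesis
    by (simp add: field_simps)
qed

text \<open>The generating functions at x + 1 and x differ by X e^(xX). At n = 0 the truncated
  exponent is harmless, since the factor \<open>real n\<close> vanishes.\<close>

lemma bernoulli_poly_add_1: "bernoulli_poly n (x + 1) = bernoulli_poly n x + real n * x ^ (n - 1)"
proof -
  have E: "fps_exp (x + 1) = fps_exp x * fps_exp (1::real)"
    by (simp add: fps_exp_add_mult)
  have "(bernoulli_gf 1 (x + 1) - bernoulli_gf 1 x) * (fps_exp 1 - 1)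
      = fps_X * fps_exp x * (fps_exp 1 - 1)"
    using bernoulli_gf_eq[of 1 x] bernoulli_gf_eq[of 1 "x + 1"]
    by (simp add: algebra_simps E[unfolded add.commute[of x]])
  then have "bernoulli_gf 1 (x + 1) - bernoulli_gf 1 x = fps_X * fps_exp x"
    using fps_exp_minus_1_nonzero[of 1] by simp
  then have "fps_nth (bernoulli_gf 1 (x + 1) - bernoulli_gf 1 x) n = fps_nth (fps_X * fps_exp x) n"
    by simp
  then have "bernoulli_poly n (x + 1) / fact n - bernoulli_poly n x / fact n =
      (if n = 0 then 0 else x ^ (n - 1) / fact (n - 1))"
    by simp
  moreover have "fact n * (if n = 0 then 0 else x ^ (n - 1) / fact (n - 1)) = real n * x ^ (n - 1)"
    by (cases n) (simp_all del: of_nat_Suc)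
  ultimately show ?thesis
    by (simp add: field_simps del: fact_Suc)
qed

lemma bernoulli_poly_0 [simp]: "bernoulli_poly 0 x = 1"
  and bernoulli_poly_1: "bernoulli_poly 1 x = x - 1 / 2"
proof -
  have N: "fps_nth (bernoulli_gf 1 x * (fps_exp 1 - 1)) n = fps_nth (fps_X * fps_exp x) n" for n
    using bernoulli_gf_eq[of 1 x] by simp
  \<comment> \<open>The series e^X - 1 starts with X, so the values for n = 0 and n = 1 are read off
    from the coefficients of X and X^2.\<close>
  show 0: "bernoulli_poly 0 x = 1"
    using N[of 1] by (simp add: fps_mult_nth)
  show "bernoulli_poly 1 x = x - 1 / 2"
    using N[of 2] 0 by (simp add: fps_mult_nth numeral_2_eq_2)
qed

text \<open>With q = 1/a, the geometric sum of the e^(rqX) is (e^X - 1) / (e^(qX) - 1). Hence the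
  generating functions at (x + r)/a add up to a times the one at x with parameter q. Both
  denominators are multiplied in first and cancelled at the end.\<close>

lemma bernoulli_poly_multiplication:
  assumes "a > 0"
  shows "real a ^ m * (\<Sum>r<a. bernoulli_poly m ((x + real r) / real a)) = real a * bernoulli_poly m x"
proof -
  define q :: real where "q = 1 / real a"
  have q: "q \<noteq> 0" "real a * q = 1" using assms by (simp_all add: q_def)
  have pow: "fps_exp q ^ r = fps_exp (real r * q)" for r
    by (simp add: fps_exp_power_mult)
  have geo: "(\<Sum>r<a. fps_exp q ^ r) * (fps_exp q - 1) = fps_exp 1 - 1"
    using power_diff_1_eq[of "fps_exp q" a] by (simp only: pow q(2) mult.commute[of "fps_exp q - 1"])
  have ex: "fps_exp (1 * ((x + real r) / real a)) = fps_exp (q * x) * fps_exp q ^ r" for r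
    by (simp add: pow flip: fps_exp_add_mult) (simp add: q_def add_divide_distrib)
  have "(\<Sum>r<a. bernoulli_gf 1 ((x + real r) / real a)) * (fps_exp 1 - 1) * (fps_exp q - 1)
      = fps_X * fps_exp (q * x) * (\<Sum>r<a. fps_exp q ^ r) * (fps_exp q - 1)"
    unfolding sum_distrib_right bernoulli_gf_eq ex by (simp add: sum_distrib_left sum_distrib_right mult.assoc)
  also have "\<dots> = fps_X * fps_exp (q * x) * (fps_exp 1 - 1)"
    by (simp only: mult.assoc geo)
  also have "\<dots> = fps_const (real a) * (bernoulli_gf q x * (fps_exp q - 1)) * (fps_exp 1 - 1)"
  proof -
    have "fps_const (real a) * (fps_const q * fps_X) = fps_X"
      by (simp only: fps_const_mult q mult.assoc[symmetric]) simp
    then show ?thesis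
      unfolding bernoulli_gf_eq by (metis mult.assoc)
  qed
  also have "\<dots> = fps_const (real a) * bernoulli_gf q x * (fps_exp 1 - 1) * (fps_exp q - 1)"
    by (simp add: mult_ac)
  finally have "(\<Sum>r<a. bernoulli_gf 1 ((x + real r) / real a)) = fps_const (real a) * bernoulli_gf q x"
    using fps_exp_minus_1_nonzero[of 1] fps_exp_minus_1_nonzero[of q] q by simp
  then have "fps_nth (\<Sum>r<a. bernoulli_gf 1 ((x + real r) / real a)) m
      = fps_nth (fps_const (real a) * bernoulli_gf q x) m"
    by simp
  then have "(\<Sum>r<a. bernoulli_poly m ((x + real r) / real a)) = real a * (bernoulli_poly m x * q ^ m)"
    by (simp add: fps_sum_nth flip: sum_divide_distrib)
  then show ?thesis
    using assms by (simp add: q_def power_one_over field_simps)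
qed

text \<open>After multiplication by the common denominator \<open>D\<close>, the partial fraction
  identity becomes S T - 1 = (T - 1) + T (S - 1). The three hypotheses make \<open>D\<close>
  nonzero, so that it can be cancelled.\<close>

lemma bernoulli_gf_three_term:
  assumes "s \<noteq> 0" "t \<noteq> 0" "s + t \<noteq> 0"
  shows "fps_const (s + t) * bernoulli_gf s u * bernoulli_gf t v =
         fps_const t * bernoulli_gf s (u - v) * bernoulli_gf (s + t) v +
         fps_const s * bernoulli_gf (- t) (u - v) * bernoulli_gf (s + t) u"
proof -
  define S T where "S = fps_exp s" and "T = fps_exp t"
  define D where "D = (S - 1) * (T - 1) * (S * T - 1)"
  have ST: "fps_exp (s + t) = S * T"
    by (simp add: S_def T_def fps_exp_add_mult)
  have D: "D \<noteq> 0"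
    using assms fps_exp_minus_1_nonzero[of s] fps_exp_minus_1_nonzero[of t]
      fps_exp_minus_1_nonzero[of "s + t"]
    unfolding D_def ST S_def T_def by simp
  define E where "E = fps_exp (s * u) * fps_exp (t * v)"
  have E1: "fps_exp (s * (u - v)) * fps_exp ((s + t) * v) = E"
    unfolding E_def by (simp flip: fps_exp_add_mult add: algebra_simps)
  \<comment> \<open>The additional factor \<open>T\<close> comes from the reflected argument 1 - (u
    - v) that parameter -t brings; it is the numerator of the second partial fraction.\<close>
  have E2: "fps_exp (t * (1 - (u - v))) * fps_exp ((s + t) * u) = T * E"
    unfolding E_def T_def by (simp flip: fps_exp_add_mult add: algebra_simps)
  define c where "c = fps_const s * fps_const t * fps_const (s + t) * fps_X ^ 2"
  have "fps_const (s + t) * bernoulli_gf s u * bernoulli_gf t v * D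
      = fps_const (s + t) * (bernoulli_gf s u * (S - 1)) * (bernoulli_gf t v * (T - 1)) * (S * T - 1)"
    by (simp only: D_def mult_ac)
  also have "\<dots> = c * E * (S * T - 1)"
    unfolding S_def T_def bernoulli_gf_eq E_def c_def power2_eq_square by (simp only: mult_ac)
  also have "\<dots> = c * E * (T - 1) + c * (T * E) * (S - 1)"
    by (simp add: algebra_simps)
  also have "c * E * (T - 1) = fps_const t * (bernoulli_gf s (u - v) * (S - 1)) *
                                 (bernoulli_gf (s + t) v * (S * T - 1)) * (T - 1)"
    unfolding E1[symmetric] ST[symmetric] unfolding S_def bernoulli_gf_eq c_def power2_eq_square
    by (simp only: mult_ac)
  also have "c * (T * E) * (S - 1) = fps_const s * (bernoulli_gf (- t) (u - v) * (T - 1)) *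
                                 (bernoulli_gf (s + t) u * (S * T - 1)) * (S - 1)"
    unfolding E2[symmetric] ST[symmetric]
    unfolding T_def bernoulli_gf_eq bernoulli_gf_minus_eq c_def power2_eq_square
    by (simp only: mult_ac)
  also have "fps_const t * (bernoulli_gf s (u - v) * (S - 1)) *
               (bernoulli_gf (s + t) v * (S * T - 1)) * (T - 1) +
             fps_const s * (bernoulli_gf (- t) (u - v) * (T - 1)) *
               (bernoulli_gf (s + t) u * (S * T - 1)) * (S - 1) =
             (fps_const t * bernoulli_gf s (u - v) * bernoulli_gf (s + t) v +
              fps_const s * bernoulli_gf (- t) (u - v) * bernoulli_gf (s + t) u) * D"
    unfolding D_def distrib_right by (simp only: mult_ac)
  finally show ?thesis
    using D by simp
qed

section \<open>Products of Bernoulli polynomials\<close>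

lemma poly_eqI_infinite:
  fixes p q :: "real poly"
  assumes "infinite A" "\<And>x. x \<in> A \<Longrightarrow> poly p x = poly q x"
  shows "p = q"
proof (rule ccontr)
  assume "p \<noteq> q"
  then have "finite {x. poly (p - q) x = 0}"
    by (intro poly_roots_finite) simp
  moreover have "A \<subseteq> {x. poly (p - q) x = 0}"
    using assms(2) by auto
  ultimately show False
    using assms(1) finite_subset by blast
qed

text \<open>The quotient of s^k - (-1)^k by s + 1, for the one part of the three-term relation where
  the factor s + 1 is not visible.\<close>

lemma alternating_geometric_sum:
  fixes s :: real
  shows "(s + 1) * (\<Sum>i<k. (- 1) ^ (k - 1 - i) * s ^ i) = s ^ k - (- 1) ^ k"
proof (cases k)
  case (Suc k')
  have "s ^ Suc k' - (- 1) ^ Suc k' = (s - (-1)) * (\<Sum>p<Suc k'. s ^ p * (- 1) ^ (k' - p))"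
    by (rule diff_power_eq_sum)
  then show ?thesis
    unfolding Suc by (simp add: mult.commute)
qed simp

text \<open>This compares coefficients of s^m t^n in the three-term relation after division by s +
  t. By homogeneity t = 1 suffices: the coefficient of X^(m+n) is then a polynomial identity in s,
  and the coefficient of s^m is taken. The last term is what the summands with j = m + n leave
  behind.\<close>

lemma bernoulli_poly_product_coeffs:
  fixes u v :: real
  defines "\<beta> \<equiv> \<lambda>k x. bernoulli_poly k x / fact k"
  assumes "m \<ge> 1" "n \<ge> 1"
  shows "\<beta> m u * \<beta> n v =
    (\<Sum>j=0..m. real ((m + n - j - 1) choose (m - j)) * \<beta> j (u - v) * \<beta> (m + n - j) v) +
    (\<Sum>j=0..n. real ((m + n - j - 1) choose (m - 1)) * ((- 1) ^ j * \<beta> j (u - v)) * \<beta> (m + n - j) u) +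
    (- 1) ^ (n - 1) * \<beta> (m + n) (u - v)"
proof -
  define N where "N = m + n"
  define w where "w = u - v"
  have N: "N \<ge> 2" "m < N" "n < N" using assms by (auto simp: N_def)
  \<comment> \<open>coefficient of \<open>X\<^bsup>N\<^esup>\<close> in the three-term relation at \<open>t = 1\<close>, divided by \<open>s + 1\<close>, as polynomials in \<open>s\<close>\<close>
  define p where "p = (\<Sum>i=0..N. monom (\<beta> i u * \<beta> (N - i) v) i)"
  define q where "q = (\<Sum>j<N. monom (\<beta> j w * \<beta> (N - j) v) j * [:1, 1:] ^ (N - j - 1)) +
                      (\<Sum>j<N. monom ((- 1) ^ j * \<beta> j w * \<beta> (N - j) u) 1 * [:1, 1:] ^ (N - j - 1)) +
                      monom (\<beta> N w) 1 * (\<Sum>i<N - 1. monom ((- 1) ^ (N - 2 - i)) i)"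
  \<comment> \<open>For positive s the three-term relation applies at t = 1, and infinitely many
    such s determine the polynomials.\<close>
  have "poly p s = poly q s" if "s > 0" for s
  proof -
    have s: "s \<noteq> 0" "s + 1 \<noteq> 0" using that by auto
    have "fps_nth (fps_const (s + 1) * bernoulli_gf s u * bernoulli_gf 1 v) N =
      fps_nth (fps_const 1 * bernoulli_gf s (u - v) * bernoulli_gf (s + 1) v +
         fps_const s * bernoulli_gf (- 1) (u - v) * bernoulli_gf (s + 1) u) N"
      using bernoulli_gf_three_term[of s 1 u v] s by simp
    then have "(s + 1) * (\<Sum>i=0..N. \<beta> i u * s ^ i * \<beta> (N - i) v) =
        (\<Sum>j=0..N. \<beta> j w * s ^ j * (\<beta> (N - j) v * (s + 1) ^ (N - j))) +
        s * (\<Sum>j=0..N. \<beta> j w * (- 1) ^ j * (\<beta> (N - j) u * (s + 1) ^ (N - j)))"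
      unfolding mult.assoc fps_add_nth fps_mult_left_const_nth
      unfolding fps_mult_nth bernoulli_gf_nth
      by (simp add: \<beta>_def w_def mult_ac)
    \<comment> \<open>Every term with j < N has a factor s + 1; the term j = N has none and is split
      off. The same is done for the second sum.\<close>
    also have "(\<Sum>j=0..N. \<beta> j w * s ^ j * (\<beta> (N - j) v * (s + 1) ^ (N - j))) =
        (s + 1) * (\<Sum>j<N. \<beta> j w * \<beta> (N - j) v * s ^ j * (s + 1) ^ (N - j - 1)) + \<beta> N w * s ^ N"
    proof -
      have "{0..N} = insert N {..<N}" by auto
      then have "(\<Sum>j=0..N. \<beta> j w * s ^ j * (\<beta> (N - j) v * (s + 1) ^ (N - j))) =
          \<beta> N w * s ^ N + (\<Sum>j<N. \<beta> j w * s ^ j * (\<beta> (N - j) v * (s + 1) ^ (N - j)))"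
        by (simp add: \<beta>_def)
      also have "(\<Sum>j<N. \<beta> j w * s ^ j * (\<beta> (N - j) v * (s + 1) ^ (N - j))) =
          (\<Sum>j<N. (s + 1) * (\<beta> j w * \<beta> (N - j) v * s ^ j * (s + 1) ^ (N - j - 1)))"
      proof (intro sum.cong refl)
        fix j assume "j \<in> {..<N}"
        then have "N - j = Suc (N - j - 1)" by simp
        then have "(s + 1) ^ (N - j) = (s + 1) * (s + 1) ^ (N - j - 1)"
          by (metis power_Suc)
        then show "\<beta> j w * s ^ j * (\<beta> (N - j) v * (s + 1) ^ (N - j)) =
            (s + 1) * (\<beta> j w * \<beta> (N - j) v * s ^ j * (s + 1) ^ (N - j - 1))"
          by (simp only: mult_ac)
      qed
      finally show ?thesis by (simp add: sum_distrib_left)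
    qed
    also have "(\<Sum>j=0..N. \<beta> j w * (- 1) ^ j * (\<beta> (N - j) u * (s + 1) ^ (N - j))) =
        (s + 1) * (\<Sum>j<N. (- 1) ^ j * \<beta> j w * \<beta> (N - j) u * (s + 1) ^ (N - j - 1)) + \<beta> N w * (- 1) ^ N"
    proof -
      have "{0..N} = insert N {..<N}" by auto
      then have "(\<Sum>j=0..N. \<beta> j w * (- 1) ^ j * (\<beta> (N - j) u * (s + 1) ^ (N - j))) =
          \<beta> N w * (- 1) ^ N + (\<Sum>j<N. \<beta> j w * (- 1) ^ j * (\<beta> (N - j) u * (s + 1) ^ (N - j)))"
        by (simp add: \<beta>_def)
      also have "(\<Sum>j<N. \<beta> j w * (- 1) ^ j * (\<beta> (N - j) u * (s + 1) ^ (N - j))) =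
          (\<Sum>j<N. (s + 1) * ((- 1) ^ j * \<beta> j w * \<beta> (N - j) u * (s + 1) ^ (N - j - 1)))"
      proof (intro sum.cong refl)
        fix j assume "j \<in> {..<N}"
        then have "N - j = Suc (N - j - 1)" by simp
        then have "(s + 1) ^ (N - j) = (s + 1) * (s + 1) ^ (N - j - 1)"
          by (metis power_Suc)
        then show "\<beta> j w * (- 1) ^ j * (\<beta> (N - j) u * (s + 1) ^ (N - j)) =
            (s + 1) * ((- 1) ^ j * \<beta> j w * \<beta> (N - j) u * (s + 1) ^ (N - j - 1))"
          by (simp only: mult_ac)
      qed
      finally show ?thesis by (simp add: sum_distrib_left)
    qed
    \<comment> \<open>The two terms split off are divisible by s + 1 only jointly: s^N + (-1)^N s =
      s (s^(N-1) - (-1)^(N-1)).\<close>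
    also have "(s + 1) * (\<Sum>j<N. \<beta> j w * \<beta> (N - j) v * s ^ j * (s + 1) ^ (N - j - 1)) + \<beta> N w * s ^ N +
        s * ((s + 1) * (\<Sum>j<N. (- 1) ^ j * \<beta> j w * \<beta> (N - j) u * (s + 1) ^ (N - j - 1)) + \<beta> N w * (- 1) ^ N) =
        (s + 1) * ((\<Sum>j<N. \<beta> j w * \<beta> (N - j) v * s ^ j * (s + 1) ^ (N - j - 1)) +
          s * (\<Sum>j<N. (- 1) ^ j * \<beta> j w * \<beta> (N - j) u * (s + 1) ^ (N - j - 1))) +
        \<beta> N w * s * (s ^ (N - 1) - (- 1) ^ (N - 1))"
      using N by (cases N) (simp_all add: algebra_simps)
    also have "\<dots> = (s + 1) * ((\<Sum>j<N. \<beta> j w * \<beta> (N - j) v * s ^ j * (s + 1) ^ (N - j - 1)) +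
          s * (\<Sum>j<N. (- 1) ^ j * \<beta> j w * \<beta> (N - j) u * (s + 1) ^ (N - j - 1)) +
        \<beta> N w * s * (\<Sum>i<N-1. (- 1) ^ (N - 1 - 1 - i) * s ^ i))"
      unfolding alternating_geometric_sum[symmetric] by (simp only: distrib_left mult_ac)
    finally have "(\<Sum>i=0..N. \<beta> i u * s ^ i * \<beta> (N - i) v) =
        (\<Sum>j<N. \<beta> j w * \<beta> (N - j) v * s ^ j * (s + 1) ^ (N - j - 1)) +
          s * (\<Sum>j<N. (- 1) ^ j * \<beta> j w * \<beta> (N - j) u * (s + 1) ^ (N - j - 1)) +
        \<beta> N w * s * (\<Sum>i<N-1. (- 1) ^ (N - 1 - 1 - i) * s ^ i)"
      using s by simp
    then show ?thesis
      by (simp add: p_def q_def poly_sum poly_monom sum_distrib_left mult_ac add.commute numeral_2_eq_2)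
  qed
  then have "p = q"
    by (intro poly_eqI_infinite[of "{0<..}"]) (auto simp: infinite_Ioi)
  then have "coeff p m = coeff q m" by simp
  moreover have "coeff p m = \<beta> m u * \<beta> n v"
    using N by (simp add: p_def coeff_sum N_def)
  \<comment> \<open>The summands s^j (1+s)^(N-j-1) and s (1+s)^(N-j-1) contribute binomial
    coefficients that vanish for j > m and j > n respectively, which shortens both ranges.\<close>
  moreover have "coeff q m =
    (\<Sum>j=0..m. real ((N - j - 1) choose (m - j)) * \<beta> j w * \<beta> (N - j) v) +
    (\<Sum>j=0..n. real ((N - j - 1) choose (m - 1)) * ((- 1) ^ j * \<beta> j w) * \<beta> (N - j) u) +
    (- 1) ^ (n - 1) * \<beta> N w"
  proof -
    have lin: "coeff ([:1, 1:] ^ k :: real poly) i = real (k choose i)" for k i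
    proof (cases "i \<le> k")
      case False
      then have "degree ([:1, 1:] ^ k :: real poly) < i"
        by (simp add: degree_power_eq)
      then show ?thesis
        using False by (simp add: coeff_eq_0)
    qed (simp add: coeff_linear_poly_power)
    have "(\<Sum>j<N. coeff (monom (\<beta> j w * \<beta> (N - j) v) j * [:1, 1:] ^ (N - j - 1)) m) =
        (\<Sum>j=0..m. real ((N - j - 1) choose (m - j)) * \<beta> j w * \<beta> (N - j) v)"
      using N by (intro sum.mono_neutral_cong_right) (auto simp: coeff_monom_mult lin)
    moreover have "(\<Sum>j<N. coeff (monom ((- 1) ^ j * \<beta> j w * \<beta> (N - j) u) 1 * [:1, 1:] ^ (N - j - 1)) m) =
        (\<Sum>j=0..n. real ((N - j - 1) choose (m - 1)) * ((- 1) ^ j * \<beta> j w) * \<beta> (N - j) u)"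
      using N assms(2) by (intro sum.mono_neutral_cong_right) (auto simp: coeff_monom_mult lin N_def)
    \<comment> \<open>The factor s lowers the index to m - 1, and the sign exponent becomes N - 2 -
      (m - 1) = n - 1.\<close>
    moreover have "coeff (monom (\<beta> N w) 1 * (\<Sum>i<N - 1. monom ((- 1) ^ (N - 2 - i)) i)) m =
        (- 1) ^ (n - 1) * \<beta> N w"
    proof -
      have "m - 1 < N - 1" "N - 2 - (m - 1) = n - 1" using assms(2,3) by (auto simp: N_def)
      then show ?thesis
        using assms(2) by (simp add: coeff_monom_mult coeff_sum)
    qed
    ultimately show ?thesis
      by (simp only: q_def coeff_add coeff_sum)
  qed
  ultimately show ?thesis
    by (simp add: N_def w_def)
qed

text \<open>The coefficient identity multiplied by m! n!, with the binomial coefficients brought to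
  the shape of the final formula.\<close>

lemma bernoulli_poly_product:
  assumes "m \<ge> 1" "n \<ge> 1"
  shows "bernoulli_poly m u * bernoulli_poly n v =
    real n * (\<Sum>j=0..m. real (m choose j) / real (m + n - j) *
      (bernoulli_poly j (u - v) * bernoulli_poly (m + n - j) v)) +
    real m * (\<Sum>j=0..n. real (n choose j) / real (m + n - j) *
      ((- 1) ^ j * bernoulli_poly j (u - v) * bernoulli_poly (m + n - j) u)) +
    (- 1) ^ (n - 1) * fact m * fact n / fact (m + n) * bernoulli_poly (m + n) (u - v)"
proof -
  have c: "fact k * fact l * real ((k + l - j - 1) choose (k - j)) / (fact j * fact (k + l - j)) =
        real l * (real (k choose j) / real (k + l - j))" if "j \<le> k" "l \<ge> 1" for j k l :: nat
  proof -
    obtain l' where l: "l = Suc l'" using \<open>l \<ge> 1\<close> by (cases l) auto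
    have "real ((k - j + l') choose (k - j)) = fact (k - j + l') / (fact (k - j) * fact l')"
      by (subst binomial_fact) simp_all
    moreover have "real (k choose j) = fact k / (fact j * fact (k - j))"
      using that by (subst binomial_fact) simp_all
    moreover have "k + l - j - 1 = k - j + l'" "k + l - j = Suc (k - j + l')"
      using that l by auto
    ultimately have "fact k * fact l * real ((k + l - j - 1) choose (k - j)) / (fact j * fact (k + l - j)) =
        fact k * (real (Suc l') * fact l') * (fact (k - j + l') / (fact (k - j) * fact l')) /
        (fact j * (real (Suc (k - j + l')) * fact (k - j + l')))"
      and "real l * (real (k choose j) / real (k + l - j)) =
        real (Suc l') * (fact k / (fact j * fact (k - j)) / real (Suc (k - j + l')))"
      by (simp_all only: l fact_Suc)
    then show ?thesis
      by (simp add: mult_ac del: of_nat_Suc)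
  qed
  have c1: "real ((m + n - j - 1) choose (m - j)) / (fact j * fact (m + n - j)) * (fact m * fact n) =
        real n * (real (m choose j) / real (m + n - j))" if "j \<le> m" for j
    using c[of j m n] that assms by (simp add: mult_ac)
  have c2: "real ((m + n - j - 1) choose (m - 1)) / (fact j * fact (m + n - j)) * (fact m * fact n) =
        real m * (real (n choose j) / real (m + n - j))" if "j \<le> n" for j
  proof -
    \<comment> \<open>Binomial symmetry reduces this case to \<open>c\<close> with m and n
      exchanged.\<close>
    have "(m + n - j - 1) choose (m - 1) = (m + n - j - 1) choose (n - j)"
      using binomial_symmetric[of "m - 1" "m + n - j - 1"] assms that by simp
    then show ?thesis
      using c[of j n m] that assms by (simp add: mult_ac add.commute)
  qed
  let ?B = "\<lambda>k x. bernoulli_poly k x / fact k"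
  have "bernoulli_poly m u * bernoulli_poly n v = ?B m u * ?B n v * (fact m * fact n)"
    by simp
  also have "?B m u * ?B n v =
    (\<Sum>j=0..m. real ((m + n - j - 1) choose (m - j)) * ?B j (u - v) * ?B (m + n - j) v) +
    (\<Sum>j=0..n. real ((m + n - j - 1) choose (m - 1)) * ((- 1) ^ j * ?B j (u - v)) * ?B (m + n - j) u) +
    (- 1) ^ (n - 1) * ?B (m + n) (u - v)"
    by (rule bernoulli_poly_product_coeffs[OF assms])
  also have "\<dots> * (fact m * fact n) =
    (\<Sum>j=0..m. real ((m + n - j - 1) choose (m - j)) / (fact j * fact (m + n - j)) * (fact m * fact n) *
      (bernoulli_poly j (u - v) * bernoulli_poly (m + n - j) v)) +
    (\<Sum>j=0..n. real ((m + n - j - 1) choose (m - 1)) / (fact j * fact (m + n - j)) * (fact m * fact n) *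
      ((- 1) ^ j * bernoulli_poly j (u - v) * bernoulli_poly (m + n - j) u)) +
    (- 1) ^ (n - 1) * fact m * fact n / fact (m + n) * bernoulli_poly (m + n) (u - v)"
    unfolding distrib_right sum_distrib_right by (simp add: mult_ac)
  also have "(\<Sum>j=0..m. real ((m + n - j - 1) choose (m - j)) / (fact j * fact (m + n - j)) * (fact m * fact n) *
      (bernoulli_poly j (u - v) * bernoulli_poly (m + n - j) v)) =
      real n * (\<Sum>j=0..m. real (m choose j) / real (m + n - j) *
      (bernoulli_poly j (u - v) * bernoulli_poly (m + n - j) v))"
    unfolding sum_distrib_left mult.assoc[of "real _" "real _ / _", symmetric]
    by (intro sum.cong refl) (simp only: c1 atLeastAtMost_iff)
  also have "(\<Sum>j=0..n. real ((m + n - j - 1) choose (m - 1)) / (fact j * fact (m + n - j)) * (fact m * fact n) *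
      ((- 1) ^ j * bernoulli_poly j (u - v) * bernoulli_poly (m + n - j) u)) =
      real m * (\<Sum>j=0..n. real (n choose j) / real (m + n - j) *
      ((- 1) ^ j * bernoulli_poly j (u - v) * bernoulli_poly (m + n - j) u))"
    unfolding sum_distrib_left mult.assoc[of "real _" "real _ / _", symmetric]
    by (intro sum.cong refl) (simp only: c2 atLeastAtMost_iff)
  finally show ?thesis .
qed

section \<open>Bernoulli functions\<close>

text \<open>Since B_1(0) = -1/2 while the Bernoulli function of index 1 is 0 at integers, 1/2 has to
  be added exactly there. All later treatment of integer arguments goes through this
  correction.\<close>

lemma bernoulli_fun_eq_poly:
  "bernoulli_fun n x = bernoulli_poly n (frac x) + (if n = 1 \<and> x \<in> \<int> then 1 / 2 else 0)"
  by (auto simp: bernoulli_fun_def bernoulli_poly_1[unfolded One_nat_def] elim!: Ints_cases)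

lemma bernoulli_fun_add_of_int [simp]: "bernoulli_fun n (x + of_int k) = bernoulli_fun n x"
proof -
  have "x + of_int k \<in> \<int> \<longleftrightarrow> x \<in> \<int>"
    by (metis Ints_add Ints_diff Ints_of_int add_diff_cancel_right')
  moreover have "frac (x + of_int k) = frac x"
    by (simp add: frac_def)
  ultimately show ?thesis
    by (simp add: bernoulli_fun_eq_poly)
qed

text \<open>Reflection and the difference equation both express B_n(1) through B_n(0); the term n
  0^(n-1) is nonzero only for n = 1.\<close>

lemma bernoulli_poly_0_parity: "n \<noteq> 1 \<Longrightarrow> (- 1) ^ n * bernoulli_poly n 0 = bernoulli_poly n 0"
  using bernoulli_poly_reflect[of n 0] bernoulli_poly_add_1[of n 0]
  by (cases n) (auto simp: power_0_left split: if_splits)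

text \<open>Off the integers this is the reflection formula. At integers the case n = 1 holds
  because the value there is 0.\<close>

lemma bernoulli_fun_minus: "bernoulli_fun n (- x) = (- 1) ^ n * bernoulli_fun n x"
proof (cases "x \<in> \<int>")
  case True
  then obtain k where k: "x = of_int k" by (auto elim: Ints_cases)
  have "bernoulli_fun n (- x) = bernoulli_fun n 0" "bernoulli_fun n x = bernoulli_fun n 0"
    using bernoulli_fun_add_of_int[of n 0 k] bernoulli_fun_add_of_int[of n 0 "- k"] by (simp_all add: k)
  moreover have "bernoulli_fun n 0 = (- 1) ^ n * bernoulli_fun n 0"
    using bernoulli_poly_0_parity[of n] by (cases "n = 1") (simp_all add: bernoulli_fun_def)
  ultimately show ?thesis by simp
next
  case False
  then have "frac (- x) = 1 - frac x" "- x \<notin> \<int>" by (auto simp: frac_neg)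
  with False show ?thesis
    by (simp add: bernoulli_fun_eq_poly bernoulli_poly_reflect)
qed

section \<open>Sums of periodic functions over residue systems\<close>

text \<open>As e is invertible modulo c, the map k -> e k + d permutes the residues: it is injective
  modulo c, and the cardinalities agree.\<close>

lemma sum_complete_residues:
  fixes f :: "int \<Rightarrow> real"
  assumes "c > 0" "coprime e c" "\<And>i. f (i mod c) = f i"
  shows "(\<Sum>k=1..c. f (e * k + d)) = (\<Sum>r=0..<c. f r)"
proof -
  let ?g = "\<lambda>k. (e * k + d) mod c"
  have inj: "inj_on ?g {1..c}"
  proof (rule inj_onI)
    fix k l assume kl: "k \<in> {1..c}" "l \<in> {1..c}" and "?g k = ?g l"
    then have "c dvd e * (k - l)"
      by (simp add: mod_eq_dvd_iff right_diff_distrib)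
    then have "c dvd k - l"
      using assms(2) by (metis coprime_commute coprime_dvd_mult_right_iff)
    moreover have "\<bar>k - l\<bar> < c" using kl by auto
    ultimately show "k = l"
      using dvd_imp_le_int[of "k - l" c] assms(1) by fastforce
  qed
  have "?g ` {1..c} = {0..<c}"
  proof (rule card_subset_eq)
    show "?g ` {1..c} \<subseteq> {0..<c}" using assms(1) by auto
    show "card (?g ` {1..c}) = card {0..<c}" using inj by (simp add: card_image)
  qed simp
  with inj have "bij_betw ?g {1..c} {0..<c}"
    by (simp add: bij_betw_def)
  then have "(\<Sum>k=1..c. f (?g k)) = (\<Sum>r=0..<c. f r)"
    by (rule sum.reindex_bij_betw)
  then show ?thesis
    by (simp add: assms(3))
qed

lemma sum_periodic_multiple:
  fixes f :: "int \<Rightarrow> real"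
  assumes "c > 0" "\<And>i. f (i mod c) = f i"
  shows "(\<Sum>k=1..int g * c. f k) = real g * (\<Sum>k=1..c. f k)"
proof (induction g)
  case (Suc g)
  define q where "q = int g * c"
  have q: "q \<ge> 0" "int (Suc g) * c = c + q"
    using assms(1) by (simp_all add: q_def distrib_right)
  then have "{1..int (Suc g) * c} = {1..q} \<union> {1 + q..c + q}"
    using assms(1) by auto
  then have "(\<Sum>k=1..int (Suc g) * c. f k) = (\<Sum>k=1..q. f k) + (\<Sum>k=1 + q..c + q. f k)"
    by (simp add: sum.union_disjoint)
  also have "(\<Sum>k=1 + q..c + q. f k) = (\<Sum>k=1..c. f (k + q))"
    by (rule sum.reindex_bij_witness[of _ "\<lambda>k. k + q" "\<lambda>k. k - q"]) auto
  also have "\<dots> = (\<Sum>k=1..c. f k)"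
  proof (intro sum.cong refl)
    fix k
    have "(k + q) mod c = k mod c" by (simp add: q_def)
    then show "f (k + q) = f k" by (metis assms(2))
  qed
  finally show ?case
    by (simp add: Suc q_def distrib_right)
qed simp

text \<open>Provides the periodicity hypothesis of the residue sums for functions of period 1
  evaluated at (y + i)/a.\<close>

lemma periodic_div_int:
  fixes F :: "real \<Rightarrow> real" and a :: int
  assumes "a \<noteq> 0" "\<And>x k. F (x + of_int k) = F x"
  shows "F ((y + of_int (i mod a)) / of_int a) = F ((y + of_int i) / of_int a)"
proof -
  have "real_of_int i = of_int (i mod a) + of_int a * of_int (i div a)"
    by (metis mod_mult_div_eq of_int_add of_int_mult)
  then have "(y + of_int i) / of_int a = (y + of_int (i mod a)) / of_int a + of_int (i div a)"
    using assms(1) by (simp add: field_simps)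
  then show ?thesis
    by (simp only: assms(2))
qed

section \<open>Multiplication formulas for Bernoulli functions and the integer indicator\<close>

text \<open>With y replaced by its fractional part f, the points (f + r)/a for 0 <= r < a lie in [0,
  1). There the polynomial formula applies, with a correction only at r = 0.\<close>

lemma bernoulli_fun_multiplication_pos:
  fixes a :: int
  assumes "a > 0"
  shows "of_int a ^ m * (\<Sum>k=1..a. bernoulli_fun m ((y + of_int k) / of_int a)) =
         of_int a * bernoulli_fun m y"
proof -
  define f where "f = frac y"
  have f: "0 \<le> f" "f < 1" by (simp_all add: f_def frac_lt_1)
  \<comment> \<open>Shifting the index by the floor of y merely permutes the residues modulo
    a.\<close>
  have "(\<Sum>k=1..a. bernoulli_fun m ((y + of_int k) / of_int a)) =
        (\<Sum>k=1..a. bernoulli_fun m ((f + of_int (1 * k + \<lfloor>y\<rfloor>)) / of_int a))"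
    by (simp add: f_def frac_def add_ac)
  also have "\<dots> = (\<Sum>r=0..<a. bernoulli_fun m ((f + of_int r) / of_int a))"
    using assms by (intro sum_complete_residues periodic_div_int) auto
  also have "\<dots> = (\<Sum>r=0..<a. bernoulli_poly m ((f + of_int r) / of_int a) +
                     (if r = 0 then if m = 1 \<and> y \<in> \<int> then 1 / 2 else 0 else 0))"
  proof (intro sum.cong refl)
    fix r assume "r \<in> {0..<a}"
    then have r: "0 \<le> r" "r + 1 \<le> a" by auto
    have "real_of_int r + 1 \<le> of_int a"
      using r(2) by (metis of_int_1 of_int_add of_int_le_iff)
    then have "0 \<le> (f + of_int r) / of_int a" "(f + of_int r) / of_int a < 1"
      using r(1) f assms by auto
    then have fr: "frac ((f + of_int r) / of_int a) = (f + of_int r) / of_int a"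
      by (simp add: frac_eq)
    have "(f + of_int r) / of_int a \<in> \<int> \<longleftrightarrow> frac ((f + of_int r) / of_int a) = 0"
      by (simp add: frac_eq_0_iff)
    also have "\<dots> \<longleftrightarrow> f + of_int r = 0"
      using assms by (simp add: fr)
    also have "\<dots> \<longleftrightarrow> r = 0 \<and> f = 0"
      using f r(1) by (auto simp: add_nonneg_eq_0_iff)
    also have "\<dots> \<longleftrightarrow> r = 0 \<and> y \<in> \<int>"
      by (simp add: f_def frac_eq_0_iff)
    finally show "bernoulli_fun m ((f + of_int r) / of_int a) =
        bernoulli_poly m ((f + of_int r) / of_int a) +
        (if r = 0 then if m = 1 \<and> y \<in> \<int> then 1 / 2 else 0 else 0)"
      by (simp add: bernoulli_fun_eq_poly fr)
  qed
  also have "\<dots> = (\<Sum>r=0..<a. bernoulli_poly m ((f + of_int r) / of_int a)) +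
                    (if m = 1 \<and> y \<in> \<int> then 1 / 2 else 0)"
    using assms by (simp add: sum.distrib)
  also have "(\<Sum>r=0..<a. bernoulli_poly m ((f + of_int r) / of_int a)) =
             (\<Sum>r<nat a. bernoulli_poly m ((f + real r) / real (nat a)))"
    using assms by (intro sum.reindex_bij_witness[of _ int nat]) auto
  finally have "of_int a ^ m * (\<Sum>k=1..a. bernoulli_fun m ((y + of_int k) / of_int a)) =
      of_int a ^ m * (\<Sum>r<nat a. bernoulli_poly m ((f + real r) / real (nat a))) +
      of_int a ^ m * (if m = 1 \<and> y \<in> \<int> then 1 / 2 else 0)"
    by (simp only: distrib_left)
  also have "of_int a ^ m * (\<Sum>r<nat a. bernoulli_poly m ((f + real r) / real (nat a))) =
      of_int a * bernoulli_poly m f"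
    using bernoulli_poly_multiplication[of "nat a" m f] assms by simp
  \<comment> \<open>The correction 1/2 appears only for m = 1, where a^m = a, so both sides carry
    the same one.\<close>
  finally show ?thesis
    by (simp add: bernoulli_fun_eq_poly f_def distrib_left)
qed

text \<open>For negative a, parity turns the points over a into points over -a, and its sign (-1)^m
  turns a^m into (-a)^m.\<close>

lemma bernoulli_fun_multiplication:
  fixes a :: int
  assumes "a \<noteq> 0"
  shows "of_int a ^ m * (\<Sum>k=1..\<bar>a\<bar>. bernoulli_fun m ((y + of_int k) / of_int a)) =
         of_int \<bar>a\<bar> * bernoulli_fun m y"
proof (cases "a > 0")
  case True
  then show ?thesis using bernoulli_fun_multiplication_pos[of a m y] by simp
next
  case False
  with assms have neg: "- a > 0" by simp
  have "bernoulli_fun m ((y + of_int k) / of_int a) =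
      (- 1) ^ m * bernoulli_fun m ((y + of_int k) / of_int (- a))" for k
    by (simp flip: bernoulli_fun_minus)
  then have "of_int a ^ m * (\<Sum>k=1..\<bar>a\<bar>. bernoulli_fun m ((y + of_int k) / of_int a)) =
      (of_int a * (- 1)) ^ m * (\<Sum>k=1..- a. bernoulli_fun m ((y + of_int k) / of_int (- a)))"
    using neg by (simp add: sum_distrib_left flip: mult.assoc power_mult_distrib)
  also have "of_int a * (- 1) = (of_int (- a) :: real)" by simp
  finally show ?thesis
    using bernoulli_fun_multiplication_pos[OF neg, of m y] neg by simp
qed

text \<open>If y is an integer, a divides exactly one of |a| consecutive values y + k; otherwise no
  quotient is an integer.\<close>

lemma sum_delta_Z:
  fixes a :: int
  assumes "a \<noteq> 0"
  shows "(\<Sum>k=1..\<bar>a\<bar>. delta_Z ((y + of_int k) / of_int a)) = delta_Z y"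
proof (cases "y \<in> \<int>")
  case False
  have "(y + of_int k) / of_int a \<notin> \<int>" for k
  proof
    assume "(y + of_int k) / of_int a \<in> \<int>"
    then obtain c where "(y + of_int k) / of_int a = of_int c" by (auto elim: Ints_cases)
    then have "y = of_int (c * a - k)"
      using assms by (simp add: field_simps)
    with False show False by (metis Ints_of_int)
  qed
  with False show ?thesis by (simp add: delta_Z_def)
next
  case True
  then obtain c where c: "y = of_int c" by (auto elim: Ints_cases)
  define h where "h i = (if a dvd i then 1 else 0 :: real)" for i
  have h: "delta_Z ((y + of_int k) / of_int a) = h (1 * k + c)" for k
  proof -
    have "(y + of_int k) / of_int a \<in> \<int> \<longleftrightarrow> a dvd k + c"
    proof
      assume "(y + of_int k) / of_int a \<in> \<int>"
      then obtain d where "(y + of_int k) / of_int a = of_int d" by (auto elim: Ints_cases)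
      then have "real_of_int (k + c) = of_int (a * d)"
        using assms by (simp add: c field_simps)
      then show "a dvd k + c"
        by (metis dvd_triv_left of_int_eq_iff)
    next
      assume "a dvd k + c"
      then obtain d where d: "k + c = a * d" by (elim dvdE)
      have "y + of_int k = of_int (k + c)" by (simp add: c)
      also have "\<dots> = of_int a * of_int d" by (simp only: d of_int_mult)
      finally show "(y + of_int k) / of_int a \<in> \<int>"
        using assms by simp
    qed
    then show ?thesis by (simp add: delta_Z_def h_def)
  qed
  have "(\<Sum>k=1..\<bar>a\<bar>. delta_Z ((y + of_int k) / of_int a)) = (\<Sum>r=0..<\<bar>a\<bar>. h r)"
    unfolding h using assms
    by (intro sum_complete_residues) (auto simp: h_def dvd_mod_iff)
  also have "\<dots> = (\<Sum>r=0..<\<bar>a\<bar>. if r = 0 then 1 else 0)"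
  proof (intro sum.cong refl)
    fix r assume "r \<in> {0..<\<bar>a\<bar>}"
    then show "h r = (if r = 0 then 1 else 0)"
      using dvd_imp_le_int[of r a] by (auto simp: h_def)
  qed
  also have "\<dots> = 1" using assms by simp
  finally show ?thesis using True by (simp add: delta_Z_def)
qed

section \<open>Products of Bernoulli functions\<close>

text \<open>The order of the fractional parts makes their difference w its own fractional part, so
  the polynomial identity applies to all three arguments. What remains is to balance the corrections
  of index 1 at integers.\<close>

lemma bernoulli_fun_product_frac_le:
  assumes "m \<ge> 1" "n \<ge> 1" "frac v \<le> frac u"
  shows "bernoulli_fun m u * bernoulli_fun n v =
    real n * (\<Sum>j=0..m. real (m choose j) / real (m + n - j) *
      (bernoulli_fun j (u - v) * bernoulli_fun (m + n - j) v)) +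
    real m * (\<Sum>j=0..n. real (n choose j) / real (m + n - j) *
      (bernoulli_fun j (v - u) * bernoulli_fun (m + n - j) u)) +
    (- 1) ^ (n - 1) * fact m * fact n / fact (m + n) * bernoulli_fun (m + n) (u - v) -
    kronecker_delta 1 m * kronecker_delta 1 n * (delta_Z u * delta_Z v / 4)"
proof -
  define f g w where "f = frac u" and "g = frac v" and "w = frac u - frac v"
  have f: "0 \<le> f" "f < 1" and g: "0 \<le> g" "g < 1" by (simp_all add: f_def g_def frac_lt_1)
  have w: "w = f - g" "0 \<le> w" using assms(3) by (simp_all add: f_def g_def w_def)
  have "u - v = w + of_int (\<lfloor>u\<rfloor> - \<lfloor>v\<rfloor>)"
    by (simp add: w_def frac_def)
  then have Bw: "bernoulli_fun j (u - v) = bernoulli_fun j w" for j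
    by (simp only: bernoulli_fun_add_of_int)
  have "bernoulli_fun j (v - u) = (- 1) ^ j * bernoulli_fun j w" for j
    using bernoulli_fun_minus[of j "u - v"] by (simp add: Bw)
  note Bw = Bw this
  have fw: "frac w = w" using f g w by (simp add: frac_eq)
  define h :: "nat \<Rightarrow> real" where "h k = (if k = 1 then 1 / 2 else 0)" for k
  define \<epsilon> \<delta> \<gamma> :: real where "\<epsilon> = delta_Z u" and "\<delta> = delta_Z v" and "\<gamma> = delta_Z w"
  have Bu: "bernoulli_fun k u = bernoulli_poly k f + \<epsilon> * h k" for k
    by (simp add: bernoulli_fun_eq_poly f_def \<epsilon>_def h_def delta_Z_def)
  have Bv: "bernoulli_fun k v = bernoulli_poly k g + \<delta> * h k" for k
    by (simp add: bernoulli_fun_eq_poly g_def \<delta>_def h_def delta_Z_def)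
  have Bww: "bernoulli_fun k w = bernoulli_poly k w + \<gamma> * h k" for k
    by (simp add: bernoulli_fun_eq_poly fw \<gamma>_def h_def delta_Z_def)
  have poly: "bernoulli_poly m f * bernoulli_poly n g =
    real n * (\<Sum>j=0..m. real (m choose j) / real (m + n - j) *
      (bernoulli_poly j w * bernoulli_poly (m + n - j) g)) +
    real m * (\<Sum>j=0..n. real (n choose j) / real (m + n - j) *
      ((- 1) ^ j * bernoulli_poly j w * bernoulli_poly (m + n - j) f)) +
    (- 1) ^ (n - 1) * fact m * fact n / fact (m + n) * bernoulli_poly (m + n) w"
    unfolding w by (rule bernoulli_poly_product) fact+
  have lin: "r * (\<Sum>j\<in>A. c j * (P j * (Q j + d * R j))) =
      r * (\<Sum>j\<in>A. c j * (P j * Q j)) + d * (r * (\<Sum>j\<in>A. c j * (P j * R j)))"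
    for c P Q R :: "nat \<Rightarrow> real" and A d r
    by (simp add: sum_distrib_left sum.distrib algebra_simps)
  have hN: "h (m + n) = 0" using assms by (simp add: h_def)
  \<comment> \<open>The index k + l - j equals 1 only for j = k and l = 1, so a single correction
    survives.\<close>
  have single: "real l * (\<Sum>j=0..k. real (k choose j) / real (k + l - j) * (F j * h (k + l - j))) = F k * h l"
    if "l \<ge> 1" for k l and F :: "nat \<Rightarrow> real"
  proof -
    have "(\<Sum>j=0..k. real (k choose j) / real (k + l - j) * (F j * h (k + l - j))) =
          (\<Sum>j=0..k. if j = k then F k * h l else 0)"
      using that by (intro sum.cong refl) (auto simp: h_def)
    then show ?thesis by (auto simp: h_def)
  qed
  have sv: "real n * (\<Sum>j=0..m. real (m choose j) / real (m + n - j) *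
      (bernoulli_poly j w * bernoulli_fun (m + n - j) v)) =
    real n * (\<Sum>j=0..m. real (m choose j) / real (m + n - j) *
      (bernoulli_poly j w * bernoulli_poly (m + n - j) g)) + \<delta> * (bernoulli_poly m w * h n)"
    unfolding Bv lin single[OF assms(2)] ..
  have su: "real m * (\<Sum>j=0..n. real (n choose j) / real (m + n - j) *
      ((- 1) ^ j * bernoulli_poly j w * bernoulli_fun (m + n - j) u)) =
    real m * (\<Sum>j=0..n. real (n choose j) / real (m + n - j) *
      ((- 1) ^ j * bernoulli_poly j w * bernoulli_poly (m + n - j) f)) +
      \<epsilon> * ((- 1) ^ n * bernoulli_poly n w * h m)"
    unfolding Bu lin single[OF assms(1), of n, unfolded add.commute[of n]] ..
  \<comment> \<open>Correcting the factor at w affects only j = 1. The second sum yields the same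
    kind of term with opposite sign, and by \<open>canc\<close> the two cancel.\<close>
  have wv: "real n * (\<Sum>j=0..m. real (m choose j) / real (m + n - j) *
      (bernoulli_fun j w * bernoulli_fun (m + n - j) v)) =
    real n * (\<Sum>j=0..m. real (m choose j) / real (m + n - j) *
      (bernoulli_poly j w * bernoulli_fun (m + n - j) v)) +
    real n * (\<gamma> * (real m / real (m + n - 1) * bernoulli_fun (m + n - 1) v / 2))"
  proof -
    have "(\<Sum>j=0..m. real (m choose j) / real (m + n - j) *
        (\<gamma> * h j * bernoulli_fun (m + n - j) v)) =
      (\<Sum>j=0..m. if j = 1 then \<gamma> * (real m / real (m + n - 1) * bernoulli_fun (m + n - 1) v / 2) else 0)"
      by (intro sum.cong refl) (auto simp: h_def algebra_simps)
    also have "\<dots> = \<gamma> * (real m / real (m + n - 1) * bernoulli_fun (m + n - 1) v / 2)"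
      using assms(1) by (subst sum.delta) auto
    finally show ?thesis
      by (simp only: Bww distrib_left distrib_right sum.distrib)
  qed
  have wu: "real m * (\<Sum>j=0..n. real (n choose j) / real (m + n - j) *
      ((- 1) ^ j * bernoulli_fun j w * bernoulli_fun (m + n - j) u)) =
    real m * (\<Sum>j=0..n. real (n choose j) / real (m + n - j) *
      ((- 1) ^ j * bernoulli_poly j w * bernoulli_fun (m + n - j) u)) -
    real m * (\<gamma> * (real n / real (m + n - 1) * bernoulli_fun (m + n - 1) u / 2))"
  proof -
    have "(\<Sum>j=0..n. real (n choose j) / real (m + n - j) *
        ((- 1) ^ j * (\<gamma> * h j) * bernoulli_fun (m + n - j) u)) =
      (\<Sum>j=0..n. if j = 1 then - (\<gamma> * (real n / real (m + n - 1) * bernoulli_fun (m + n - 1) u / 2)) else 0)"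
      by (intro sum.cong refl) (auto simp: h_def algebra_simps)
    also have "\<dots> = - (\<gamma> * (real n / real (m + n - 1) * bernoulli_fun (m + n - 1) u / 2))"
      using assms(2) by (subst sum.delta) auto
    finally show ?thesis
      by (simp only: Bww distrib_left distrib_right sum.distrib) simp
  qed
  have canc: "\<gamma> * bernoulli_fun (m + n - 1) u = \<gamma> * bernoulli_fun (m + n - 1) v"
  proof (cases "w \<in> \<int>")
    case True
    then have "w = 0" using fw by (metis frac_eq_0_iff)
    then have "u = v + of_int (\<lfloor>u\<rfloor> - \<lfloor>v\<rfloor>)" by (simp add: w_def frac_def)
    then show ?thesis by (metis bernoulli_fun_add_of_int)
  qed (simp add: \<gamma>_def delta_Z_def)
  \<comment> \<open>If u is not an integer, an integer v gives g = 0 and w = f. If u is an integer,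
    0 <= g <= f = 0 makes everything 0, and the term 1/4 arises for m = n = 1.\<close>
  have corr: "(bernoulli_poly m f + \<epsilon> * h m) * (bernoulli_poly n g + \<delta> * h n) =
      bernoulli_poly m f * bernoulli_poly n g + \<delta> * (bernoulli_poly m w * h n) +
      \<epsilon> * ((- 1) ^ n * bernoulli_poly n w * h m) -
      kronecker_delta 1 m * kronecker_delta 1 n * (\<epsilon> * \<delta> / 4)"
  proof (cases "u \<in> \<int>")
    case False
    then have "\<epsilon> = 0" by (simp add: \<epsilon>_def delta_Z_def)
    moreover have "\<delta> * (bernoulli_poly m w * h n) = \<delta> * (bernoulli_poly m f * h n)"
    proof (cases "v \<in> \<int>")
      case True
      then have "g = 0" by (simp add: g_def frac_eq_0_iff)
      then show ?thesis by (simp add: w)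
    qed (simp add: \<delta>_def delta_Z_def)
    ultimately show ?thesis by (auto simp: algebra_simps)
  next
    case True
    then have "f = 0" by (simp add: f_def frac_eq_0_iff)
    then have 0: "f = 0" "g = 0" "w = 0" using w g by auto
    then have "v \<in> \<int>" by (simp add: g_def frac_eq_0_iff)
    with True have 1: "\<epsilon> = 1" "\<delta> = 1" by (simp_all add: \<epsilon>_def \<delta>_def delta_Z_def)
    show ?thesis
      unfolding 0 1 using bernoulli_poly_0_parity[of n]
      by (cases "n = 1"; cases "m = 1")
         (simp_all add: h_def kronecker_delta_def bernoulli_poly_1[unfolded One_nat_def] algebra_simps)
  qed
  have "bernoulli_fun m u * bernoulli_fun n v =
      (bernoulli_poly m f + \<epsilon> * h m) * (bernoulli_poly n g + \<delta> * h n)"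
    by (simp only: Bu Bv)
  moreover have "bernoulli_fun (m + n) w = bernoulli_poly (m + n) w"
    by (simp add: Bww hN)
  moreover have "real n * (\<gamma> * (real m / real (m + n - 1) * bernoulli_fun (m + n - 1) v / 2)) =
      real m * (\<gamma> * (real n / real (m + n - 1) * bernoulli_fun (m + n - 1) u / 2))"
    using canc by auto
  ultimately show ?thesis
    unfolding Bw wv wu sv su corr poly \<epsilon>_def[symmetric] \<delta>_def[symmetric] by simp
qed

text \<open>The case a = b = 1. Exchanging (m, u) with (n, v) removes the order assumption; the last
  term is symmetric by parity, as (-1)^(m-1) (-1)^(m+n) = (-1)^(n-1).\<close>

lemma bernoulli_fun_product:
  assumes "m \<ge> 1" "n \<ge> 1"
  shows "bernoulli_fun m u * bernoulli_fun n v =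
    real n * (\<Sum>j=0..m. real (m choose j) / real (m + n - j) *
      (bernoulli_fun j (u - v) * bernoulli_fun (m + n - j) v)) +
    real m * (\<Sum>j=0..n. real (n choose j) / real (m + n - j) *
      (bernoulli_fun j (v - u) * bernoulli_fun (m + n - j) u)) +
    (- 1) ^ (n - 1) * fact m * fact n / fact (m + n) * bernoulli_fun (m + n) (u - v) -
    kronecker_delta 1 m * kronecker_delta 1 n * (delta_Z u * delta_Z v / 4)"
proof (cases "frac v \<le> frac u")
  case True
  then show ?thesis by (rule bernoulli_fun_product_frac_le[OF assms])
next
  case False
  then have "frac u \<le> frac v" by simp
  note * = bernoulli_fun_product_frac_le[OF assms(2,1) this]
  have "(- 1) ^ (m - 1) * bernoulli_fun (n + m) (v - u) =
        (- 1) ^ (n - 1) * bernoulli_fun (n + m) (u - v)"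
  proof -
    have "(- 1) ^ (m - 1) * (- 1 :: real) ^ (n + m) = (- 1) ^ (n - 1)"
      using assms by (cases m; cases n) (simp_all add: power_add)
    then show ?thesis
      using bernoulli_fun_minus[of "n + m" "u - v"] by (simp flip: mult.assoc)
  qed
  then have "(- 1) ^ (m - 1) * fact n * fact m / fact (n + m) * bernoulli_fun (n + m) (v - u) =
        (- 1) ^ (n - 1) * fact m * fact n / fact (n + m) * bernoulli_fun (n + m) (u - v)"
    by (simp add: mult_ac)
  then show ?thesis
    using * by (simp add: mult.commute add.commute)
qed

section \<open>Dilated arguments\<close>

text \<open>The multiplication formula solved for its right-hand side, using |a| = a sgn a and that
  sgn a is its own inverse.\<close>

lemma bernoulli_fun_expand:
  fixes a :: int
  assumes "m \<ge> 1" "a \<noteq> 0"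
  shows "bernoulli_fun m (of_int a * x + y) =
    of_int a ^ (m - 1) * of_int (sgn a) * (\<Sum>k=1..\<bar>a\<bar>. bernoulli_fun m (x + (of_int k + y) / of_int a))"
proof -
  have arg: "x + (of_int k + y) / of_int a = (of_int a * x + y + of_int k) / of_int a" for k
    using assms(2) by (simp add: field_simps)
  have "of_int a * (of_int a ^ (m - 1) * (\<Sum>k=1..\<bar>a\<bar>. bernoulli_fun m (x + (of_int k + y) / of_int a))) =
      of_int \<bar>a\<bar> * bernoulli_fun m (of_int a * x + y)"
    using bernoulli_fun_multiplication[OF assms(2), of m "of_int a * x + y"] assms(1)
    unfolding arg by (cases m) (simp_all add: mult_ac)
  also have "\<dots> = of_int a * (of_int (sgn a) * bernoulli_fun m (of_int a * x + y))"
    by (simp add: sgn_if)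
  finally have *: "of_int a ^ (m - 1) * (\<Sum>k=1..\<bar>a\<bar>. bernoulli_fun m (x + (of_int k + y) / of_int a)) =
      of_int (sgn a) * bernoulli_fun m (of_int a * x + y)"
    using assms(2) by simp
  have "of_int (sgn a) * (of_int (sgn a) :: real) = 1"
    using assms(2) by (simp add: sgn_if)
  then have "bernoulli_fun m (of_int a * x + y) =
      of_int (sgn a) * (of_int (sgn a) * bernoulli_fun m (of_int a * x + y))"
    by (simp flip: mult.assoc)
  then show ?thesis
    unfolding *[symmetric] by (simp only: mult_ac)
qed

text \<open>Here x cancels and the argument is (y - a r + k)/a, so the multiplication formula
  collapses the sum; parity produces the sign.\<close>

lemma bernoulli_fun_sum_shifted:
  fixes a :: int
  assumes "a \<noteq> 0"
  shows "of_int a ^ j * (\<Sum>k=1..\<bar>a\<bar>. bernoulli_fun j (x + (of_int k + y) / of_int a - (x + r))) =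
    of_int \<bar>a\<bar> * (- 1) ^ j * bernoulli_fun j (of_int a * r - y)"
proof -
  have "x + (of_int k + y) / of_int a - (x + r) = (- (of_int a * r - y) + of_int k) / of_int a" for k
    using assms by (simp add: field_simps)
  then show ?thesis
    using bernoulli_fun_multiplication[OF assms, of j "- (of_int a * r - y)"]
    by (simp only: bernoulli_fun_minus mult.assoc)
qed

text \<open>With a = a' g and b = b' g, the summand depends only on -a' l modulo b'. The range of l
  covers the residues modulo |b'| exactly g times, and a' is invertible there, so the multiplication
  formula for b' applies.\<close>

lemma bernoulli_fun_sum_gcd:
  fixes a b :: int
  assumes "a \<noteq> 0" "b \<noteq> 0"
  shows "of_int b ^ N * (\<Sum>l=1..\<bar>b\<bar>. bernoulli_fun N ((w - of_int (a * l)) / of_int b)) =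
    of_int \<bar>b\<bar> * of_int (gcd a b) ^ N * bernoulli_fun N (w / of_int (gcd a b))"
proof -
  define g where "g = gcd a b"
  have g: "g > 0" using assms by (simp add: g_def)
  obtain a' b' where ab: "a = a' * g" "b = b' * g" and cop: "coprime a' b'"
    using gcd_coprime_exists[of a b] assms unfolding g_def by auto
  have b': "b' \<noteq> 0" using assms ab by auto
  define c where "c = \<bar>b'\<bar>"
  have c: "c > 0" "\<bar>b\<bar> = int (nat g) * c" using b' g ab by (simp_all add: c_def abs_mult)
  define F where "F i = bernoulli_fun N ((w / of_int g + of_int i) / of_int b')" for i
  have F_dvd: "F i = F i'" if "b' dvd i - i'" for i i'
  proof -
    obtain q where "i - i' = b' * q" using \<open>b' dvd i - i'\<close> unfolding dvd_def by blast
    then have "i = i' + b' * q" by simp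
    then have "(w / of_int g + of_int i) / of_int b' =
        (w / of_int g + of_int i') / of_int b' + of_int q"
      using b' by (simp add: field_simps)
    then show ?thesis by (simp add: F_def)
  qed
  have arg: "bernoulli_fun N ((w - of_int (a * l)) / of_int b) = F (- a' * l)" for l
  proof -
    have "(w - of_int (a * l)) / of_int b = (w / of_int g + of_int (- a' * l)) / of_int b'"
      using g b' by (simp add: ab field_simps)
    then show ?thesis by (simp add: F_def)
  qed
  \<comment> \<open>The residue sums need the positive modulus c = |b'|, whereas \<open>F\<close>
    divides by b' of either sign.\<close>
  have mod: "b' dvd i mod c - i" for i
    by (metis c_def abs_dvd_iff mod_eq_dvd_iff mod_mod_trivial)
  have "(\<Sum>l=1..\<bar>b\<bar>. bernoulli_fun N ((w - of_int (a * l)) / of_int b)) =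
      real (nat g) * (\<Sum>l=1..c. F (- a' * l))"
    unfolding arg c(2)
  proof (rule sum_periodic_multiple[OF c(1)])
    show "F (- a' * (i mod c)) = F (- a' * i)" for i
      using dvd_mult[OF mod[of i], of "- a'"] by (intro F_dvd) (simp only: right_diff_distrib)
  qed
  also have "(\<Sum>l=1..c. F (- a' * l)) = (\<Sum>l=1..c. F l)"
  proof -
    have "coprime (- a') c" using cop by (simp add: c_def)
    from sum_complete_residues[OF c(1) this, of F 0] sum_complete_residues[OF c(1), of 1 F 0]
    show ?thesis by (simp add: F_dvd[OF mod])
  qed
  finally have "of_int b ^ N * (\<Sum>l=1..\<bar>b\<bar>. bernoulli_fun N ((w - of_int (a * l)) / of_int b)) =
      of_int g ^ N * of_int g * (of_int b' ^ N * (\<Sum>l=1..c. F l))"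
    using g by (simp add: ab power_mult_distrib mult_ac)
  also have "of_int b' ^ N * (\<Sum>l=1..c. F l) = of_int c * bernoulli_fun N (w / of_int g)"
    unfolding F_def c_def by (rule bernoulli_fun_multiplication[OF b'])
  also have "of_int g ^ N * of_int g * (of_int c * bernoulli_fun N (w / of_int g)) =
      of_int \<bar>b\<bar> * of_int g ^ N * bernoulli_fun N (w / of_int g)"
    using g by (simp add: c(2))
  finally show ?thesis by (simp only: g_def)
qed

text \<open>Summing over k first gives Bernoulli functions at a r - y; parity absorbs the sign, and
  the remaining sum over l is the one with the gcd.\<close>

lemma bernoulli_fun_double_sum:
  fixes a b :: int
  assumes "a \<noteq> 0" "b \<noteq> 0"
  shows "of_int a ^ N * of_int b ^ N *
      (\<Sum>k=1..\<bar>a\<bar>. \<Sum>l=1..\<bar>b\<bar>. bernoulli_fun N (x + (of_int k + y) / of_int a - (x + (of_int l + z) / of_int b))) =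
    of_int \<bar>a\<bar> * of_int \<bar>b\<bar> * of_int (gcd a b) ^ N *
      bernoulli_fun N ((of_int b * y - of_int a * z) / of_int (gcd a b))"
proof -
  have arg: "- (of_int a * ((of_int l + z) / of_int b) - y) =
      (of_int b * y - of_int a * z - of_int (a * l)) / of_int b" for l
    using assms by (simp add: field_simps)
  have "of_int a ^ N * of_int b ^ N *
      (\<Sum>k=1..\<bar>a\<bar>. \<Sum>l=1..\<bar>b\<bar>. bernoulli_fun N (x + (of_int k + y) / of_int a - (x + (of_int l + z) / of_int b))) =
    of_int b ^ N * (\<Sum>l=1..\<bar>b\<bar>. of_int a ^ N *
      (\<Sum>k=1..\<bar>a\<bar>. bernoulli_fun N (x + (of_int k + y) / of_int a - (x + (of_int l + z) / of_int b))))"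
    by (subst sum.swap) (simp add: sum_distrib_left mult_ac)
  also have "\<dots> = of_int \<bar>a\<bar> * (of_int b ^ N *
      (\<Sum>l=1..\<bar>b\<bar>. bernoulli_fun N ((of_int b * y - of_int a * z - of_int (a * l)) / of_int b)))"
    unfolding bernoulli_fun_sum_shifted[OF assms(1)] arg[symmetric] bernoulli_fun_minus
    by (simp add: sum_distrib_left mult_ac)
  also have "\<dots> = of_int \<bar>a\<bar> * (of_int \<bar>b\<bar> * of_int (gcd a b) ^ N *
      bernoulli_fun N ((of_int b * y - of_int a * z) / of_int (gcd a b)))"
    by (simp only: bernoulli_fun_sum_gcd[OF assms])
  finally show ?thesis by (simp only: mult.assoc)
qed

text \<open>Only the factor of index j depends on k, so the sum over k collapses and leaves the
  power a^(m-j). Used for both main sums, the second time with the two sets of data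
  exchanged.\<close>

lemma bernoulli_fun_resum:
  fixes a b :: int
  assumes "a \<noteq> 0" "m \<ge> 1"
  shows "of_int a ^ (m - 1) * of_int (sgn a) *
      (\<Sum>k=1..\<bar>a\<bar>. \<Sum>l=1..\<bar>b\<bar>. (\<Sum>j=0..m. real (m choose j) / real (m + n - j) *
        (bernoulli_fun j (x + (of_int k + y) / of_int a - (x + (of_int l + z) / of_int b)) *
         bernoulli_fun (m + n - j) (x + (of_int l + z) / of_int b)))) =
    (\<Sum>j=0..m. real (m choose j) * ((-1) ^ j * of_int a ^ (m - j) / real (m + n - j)) *
      (\<Sum>l=1..\<bar>b\<bar>. bernoulli_fun j (of_int a * (of_int l + z) / of_int b - y) *
        bernoulli_fun (m + n - j) (x + (of_int l + z) / of_int b)))"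
proof -
  let ?r = "\<lambda>l. (of_int l + z) / of_int b"
  have first: "of_int a ^ (m - 1) * of_int (sgn a) *
      (\<Sum>k=1..\<bar>a\<bar>. bernoulli_fun j (x + (of_int k + y) / of_int a - (x + r))) =
      (- 1) ^ j * of_int a ^ (m - j) * bernoulli_fun j (of_int a * r - y)" if "j \<le> m" for j r
  proof -
    let ?S = "\<Sum>k=1..\<bar>a\<bar>. bernoulli_fun j (x + (of_int k + y) / of_int a - (x + r))"
    \<comment> \<open>One more factor a makes the exponents add up without negative powers; it is
      cancelled at the end.\<close>
    have pw: "of_int a * of_int a ^ (m - 1) = (of_int a ^ (m - j) * of_int a ^ j :: real)"
      using assms that by (simp flip: power_Suc power_add)
    have sg: "of_int (sgn a) * of_int \<bar>a\<bar> = (of_int a :: real)"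
      by (metis of_int_mult sgn_mult_abs)
    have "of_int a * (of_int a ^ (m - 1) * of_int (sgn a) * ?S) =
        (of_int a * of_int a ^ (m - 1)) * of_int (sgn a) * ?S"
      by (simp only: mult_ac)
    also have "\<dots> = of_int a ^ (m - j) * of_int (sgn a) * (of_int a ^ j * ?S)"
      unfolding pw by (simp only: mult_ac)
    also have "\<dots> = (of_int (sgn a) * of_int \<bar>a\<bar>) *
        ((- 1) ^ j * of_int a ^ (m - j) * bernoulli_fun j (of_int a * r - y))"
      unfolding bernoulli_fun_sum_shifted[OF assms(1)] by (simp only: mult_ac)
    finally show ?thesis
      unfolding sg using assms(1) by simp
  qed
  have swap: "(\<Sum>k=1..\<bar>a\<bar>. \<Sum>l=1..\<bar>b\<bar>. \<Sum>j=0..m. f k l j) = (\<Sum>j=0..m. \<Sum>l=1..\<bar>b\<bar>. \<Sum>k=1..\<bar>a\<bar>. f k l j)"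
    for f :: "int \<Rightarrow> int \<Rightarrow> nat \<Rightarrow> real"
  proof -
    have "(\<Sum>k=1..\<bar>a\<bar>. \<Sum>l=1..\<bar>b\<bar>. \<Sum>j=0..m. f k l j) = (\<Sum>k=1..\<bar>a\<bar>. \<Sum>j=0..m. \<Sum>l=1..\<bar>b\<bar>. f k l j)"
      by (intro sum.cong refl sum.swap)
    also have "\<dots> = (\<Sum>j=0..m. \<Sum>k=1..\<bar>a\<bar>. \<Sum>l=1..\<bar>b\<bar>. f k l j)"
      by (rule sum.swap)
    also have "\<dots> = (\<Sum>j=0..m. \<Sum>l=1..\<bar>b\<bar>. \<Sum>k=1..\<bar>a\<bar>. f k l j)"
      by (intro sum.cong refl sum.swap)
    finally show ?thesis .
  qed
  have "of_int a ^ (m - 1) * of_int (sgn a) *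
      (\<Sum>k=1..\<bar>a\<bar>. \<Sum>l=1..\<bar>b\<bar>. (\<Sum>j=0..m. real (m choose j) / real (m + n - j) *
        (bernoulli_fun j (x + (of_int k + y) / of_int a - (x + ?r l)) *
         bernoulli_fun (m + n - j) (x + ?r l)))) =
      of_int a ^ (m - 1) * of_int (sgn a) *
      (\<Sum>j=0..m. \<Sum>l=1..\<bar>b\<bar>. (\<Sum>k=1..\<bar>a\<bar>. real (m choose j) / real (m + n - j) *
        (bernoulli_fun j (x + (of_int k + y) / of_int a - (x + ?r l)) *
         bernoulli_fun (m + n - j) (x + ?r l))))"
    by (simp only: swap)
  also have "\<dots> = (\<Sum>j=0..m. \<Sum>l=1..\<bar>b\<bar>. real (m choose j) / real (m + n - j) *
      ((of_int a ^ (m - 1) * of_int (sgn a) *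
        (\<Sum>k=1..\<bar>a\<bar>. bernoulli_fun j (x + (of_int k + y) / of_int a - (x + ?r l)))) *
         bernoulli_fun (m + n - j) (x + ?r l)))"
    by (simp only: sum_distrib_left sum_distrib_right mult_ac)
  also have "\<dots> = (\<Sum>j=0..m. \<Sum>l=1..\<bar>b\<bar>. real (m choose j) / real (m + n - j) *
      ((- 1) ^ j * of_int a ^ (m - j) * bernoulli_fun j (of_int a * ?r l - y) *
         bernoulli_fun (m + n - j) (x + ?r l)))"
    by (intro sum.cong refl) (simp only: first atLeastAtMost_iff)
  also have "\<dots> = (\<Sum>j=0..m. real (m choose j) * ((-1) ^ j * of_int a ^ (m - j) / real (m + n - j)) *
      (\<Sum>l=1..\<bar>b\<bar>. bernoulli_fun j (of_int a * (of_int l + z) / of_int b - y) *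
        bernoulli_fun (m + n - j) (x + (of_int l + z) / of_int b)))"
    unfolding sum_distrib_left by (intro sum.cong refl) (simp add: mult_ac del: of_nat_diff)
  finally show ?thesis .
qed

theorem theorem3p1:
  fixes m n :: nat and a b :: int and x y z :: real
  assumes "m \<ge> 1" and "n \<ge> 1" and "a \<noteq> 0" and "b \<noteq> 0"
  shows "bernoulli_fun m (of_int a * x + y) * bernoulli_fun n (of_int b * x + z) =
      real n * of_int b ^ (n - 1) * of_int (sgn b) *
        (\<Sum>j=0..m. real (m choose j) * ((-1) ^ j * of_int a ^ (m - j) / real (m + n - j)) *
          (\<Sum>l=1..\<bar>b\<bar>. bernoulli_fun j (of_int a * (of_int l + z) / of_int b - y) *
            bernoulli_fun (m + n - j) (x + (of_int l + z) / of_int b)))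
    + real m * of_int a ^ (m - 1) * of_int (sgn a) *
        (\<Sum>j=0..n. real (n choose j) * ((-1) ^ j * of_int b ^ (n - j) / real (m + n - j)) *
          (\<Sum>l=1..\<bar>a\<bar>. bernoulli_fun j (of_int b * (of_int l + y) / of_int a - z) *
            bernoulli_fun (m + n - j) (x + (of_int l + y) / of_int a)))
    + (-1) ^ (n - 1) * fact m * fact n * of_int (gcd a b) ^ (m + n) *
        bernoulli_fun (m + n) ((of_int b * y - of_int a * z) / of_int (gcd a b)) /
        (of_int a ^ n * of_int b ^ m * fact (m + n))
    - kronecker_delta 1 m * kronecker_delta 1 n * of_int (sgn (a * b)) *
        (delta_Z (of_int a * x + y) * delta_Z (of_int b * x + z) / 4)"
proof -
  define u where "u k = x + (of_int k + y) / of_int a" for k :: int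
  define v where "v l = x + (of_int l + z) / of_int b" for l :: int
  define A where "A = (of_int a ^ (m - 1) * of_int (sgn a) :: real)"
  define B where "B = (of_int b ^ (n - 1) * of_int (sgn b) :: real)"
  define N where "N = m + n"
  define P where "P k l = (\<Sum>j=0..m. real (m choose j) / real (N - j) *
      (bernoulli_fun j (u k - v l) * bernoulli_fun (N - j) (v l)))" for k l
  define Q where "Q k l = (\<Sum>j=0..n. real (n choose j) / real (N - j) *
      (bernoulli_fun j (v l - u k) * bernoulli_fun (N - j) (u k)))" for k l
  define C :: real where "C = (- 1) ^ (n - 1) * fact m * fact n / fact N"
  define \<kappa> where "\<kappa> = kronecker_delta 1 m * kronecker_delta 1 n"
  have "bernoulli_fun m (of_int a * x + y) * bernoulli_fun n (of_int b * x + z) =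
      (A * (\<Sum>k=1..\<bar>a\<bar>. bernoulli_fun m (u k))) * (B * (\<Sum>l=1..\<bar>b\<bar>. bernoulli_fun n (v l)))"
    by (simp only: A_def B_def u_def v_def
        bernoulli_fun_expand[OF assms(1,3), of x y] bernoulli_fun_expand[OF assms(2,4), of x z])
  also have "\<dots> = A * B * (\<Sum>k=1..\<bar>a\<bar>. \<Sum>l=1..\<bar>b\<bar>. bernoulli_fun m (u k) * bernoulli_fun n (v l))"
    by (simp only: mult_ac flip: sum_product)
  \<comment> \<open>The undilated product formula is applied to each pair (k, l); afterwards each of
    its four terms is summed separately.\<close>
  also have "\<dots> = A * B * (\<Sum>k=1..\<bar>a\<bar>. \<Sum>l=1..\<bar>b\<bar>. real n * P k l + real m * Q k l +
      C * bernoulli_fun N (u k - v l) - \<kappa> * (delta_Z (u k) * delta_Z (v l) / 4))"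
    unfolding bernoulli_fun_product[OF assms(1,2)] P_def Q_def C_def \<kappa>_def N_def ..
  also have "\<dots> = real n * B * (A * (\<Sum>k=1..\<bar>a\<bar>. \<Sum>l=1..\<bar>b\<bar>. P k l)) +
      real m * A * (B * (\<Sum>l=1..\<bar>b\<bar>. \<Sum>k=1..\<bar>a\<bar>. Q k l)) +
      C * (A * B * (\<Sum>k=1..\<bar>a\<bar>. \<Sum>l=1..\<bar>b\<bar>. bernoulli_fun N (u k - v l))) -
      \<kappa> * A * B * ((\<Sum>k=1..\<bar>a\<bar>. delta_Z (u k)) * (\<Sum>l=1..\<bar>b\<bar>. delta_Z (v l)) / 4)"
  proof -
    have "(\<Sum>k=1..\<bar>a\<bar>. \<Sum>l=1..\<bar>b\<bar>. real n * P k l + real m * Q k l +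
        C * bernoulli_fun N (u k - v l) - \<kappa> * (delta_Z (u k) * delta_Z (v l) / 4)) =
      real n * (\<Sum>k=1..\<bar>a\<bar>. \<Sum>l=1..\<bar>b\<bar>. P k l) + real m * (\<Sum>k=1..\<bar>a\<bar>. \<Sum>l=1..\<bar>b\<bar>. Q k l) +
      C * (\<Sum>k=1..\<bar>a\<bar>. \<Sum>l=1..\<bar>b\<bar>. bernoulli_fun N (u k - v l)) -
      \<kappa> * ((\<Sum>k=1..\<bar>a\<bar>. \<Sum>l=1..\<bar>b\<bar>. delta_Z (u k) * delta_Z (v l)) / 4)"
      by (simp add: sum.distrib sum_subtractf sum_distrib_left sum_divide_distrib)
    also have "(\<Sum>k=1..\<bar>a\<bar>. \<Sum>l=1..\<bar>b\<bar>. Q k l) = (\<Sum>l=1..\<bar>b\<bar>. \<Sum>k=1..\<bar>a\<bar>. Q k l)"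
      by (rule sum.swap)
    finally show ?thesis
      unfolding sum_product[symmetric] by (simp only: distrib_left right_diff_distrib mult_ac)
  qed
  also have "A * (\<Sum>k=1..\<bar>a\<bar>. \<Sum>l=1..\<bar>b\<bar>. P k l) =
      (\<Sum>j=0..m. real (m choose j) * ((-1) ^ j * of_int a ^ (m - j) / real (m + n - j)) *
          (\<Sum>l=1..\<bar>b\<bar>. bernoulli_fun j (of_int a * (of_int l + z) / of_int b - y) *
            bernoulli_fun (m + n - j) (x + (of_int l + z) / of_int b)))"
    unfolding A_def P_def u_def v_def N_def by (rule bernoulli_fun_resum) fact+
  also have "B * (\<Sum>l=1..\<bar>b\<bar>. \<Sum>k=1..\<bar>a\<bar>. Q k l) =
      (\<Sum>j=0..n. real (n choose j) * ((-1) ^ j * of_int b ^ (n - j) / real (m + n - j)) *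
          (\<Sum>l=1..\<bar>a\<bar>. bernoulli_fun j (of_int b * (of_int l + y) / of_int a - z) *
            bernoulli_fun (m + n - j) (x + (of_int l + y) / of_int a)))"
    unfolding B_def Q_def u_def v_def N_def add.commute[of m n]
    by (rule bernoulli_fun_resum) fact+
  also have "A * B * (\<Sum>k=1..\<bar>a\<bar>. \<Sum>l=1..\<bar>b\<bar>. bernoulli_fun N (u k - v l)) =
      of_int (gcd a b) ^ N * bernoulli_fun N ((of_int b * y - of_int a * z) / of_int (gcd a b)) /
      (of_int a ^ n * of_int b ^ m)"
  proof -
    let ?S = "\<Sum>k=1..\<bar>a\<bar>. \<Sum>l=1..\<bar>b\<bar>. bernoulli_fun N (u k - v l)"
    let ?G = "of_int (gcd a b) ^ N * bernoulli_fun N ((of_int b * y - of_int a * z) / of_int (gcd a b))"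
    have S: "of_int a ^ N * of_int b ^ N * ?S = of_int \<bar>a\<bar> * of_int \<bar>b\<bar> * ?G"
      unfolding u_def v_def using bernoulli_fun_double_sum[OF assms(3,4), of N x y z]
      by (simp only: mult.assoc)
    have A: "of_int a * A = of_int a ^ m * of_int (sgn a)"
      using assms(1) by (cases m) (simp_all add: A_def)
    have B: "of_int b * B = of_int b ^ n * of_int (sgn b)"
      using assms(2) by (cases n) (simp_all add: B_def)
    have sgn: "of_int (sgn a) * of_int \<bar>a\<bar> = (of_int a :: real)" "of_int (sgn b) * of_int \<bar>b\<bar> = (of_int b :: real)"
      by (metis of_int_mult sgn_mult_abs)+
    \<comment> \<open>The factor a b completes the exponents m - 1 and n - 1 in \<open>A\<close> and
      \<open>B\<close>; together with a^n b^m this gives the a^N b^N of the double sum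
      formula.\<close>
    have "(of_int a * of_int b) * (A * B * ?S * (of_int a ^ n * of_int b ^ m)) =
        (of_int a * A) * (of_int b * B) * ?S * (of_int a ^ n * of_int b ^ m)"
      by (simp only: mult_ac)
    also have "\<dots> = of_int (sgn a) * of_int (sgn b) * (of_int a ^ N * of_int b ^ N * ?S)"
      unfolding A B N_def power_add by (simp only: mult_ac)
    also have "\<dots> = (of_int (sgn a) * of_int \<bar>a\<bar>) * (of_int (sgn b) * of_int \<bar>b\<bar>) * ?G"
      unfolding S by (simp only: mult_ac)
    finally have "(of_int a * of_int b) * (A * B * ?S * (of_int a ^ n * of_int b ^ m)) =
        (of_int a * of_int b) * ?G"
      unfolding sgn .
    then have "A * B * ?S * (of_int a ^ n * of_int b ^ m) = ?G"
      using assms by simp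
    then show ?thesis
      using assms by (simp add: eq_divide_eq)
  qed
  also have "(\<Sum>k=1..\<bar>a\<bar>. delta_Z (u k)) = delta_Z (of_int a * x + y)"
  proof -
    have "u k = (of_int a * x + y + of_int k) / of_int a" for k
      using assms by (simp add: u_def field_simps)
    then show ?thesis using sum_delta_Z[OF assms(3)] by simp
  qed
  also have "(\<Sum>l=1..\<bar>b\<bar>. delta_Z (v l)) = delta_Z (of_int b * x + z)"
  proof -
    have "v l = (of_int b * x + z + of_int l) / of_int b" for l
      using assms by (simp add: v_def field_simps)
    then show ?thesis using sum_delta_Z[OF assms(4)] by simp
  qed
  \<comment> \<open>\<open>\<kappa>\<close> is nonzero only for m = n = 1, where \<open>A\<close>
    and \<open>B\<close> reduce to the signs.\<close>
  also have "\<kappa> * A * B = \<kappa> * of_int (sgn (a * b))"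
    by (simp add: \<kappa>_def kronecker_delta_def A_def B_def sgn_mult)
  finally show ?thesis
    by (simp add: A_def B_def C_def N_def \<kappa>_def mult_ac)
qed

end
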